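(* Let $\alpha\in(0,1)$, $\sigma=1-\alpha/2$, and let $\varepsilon>0$, $\Delta t>0$, $T_{\rm soe}>\Delta t$ together with a fixed sum-of-exponentials (SOE) approximation (nodes $\theta^\ell$, weights $\varpi^\ell$, $1\le \ell\le N_q$) be as in the context. Let $\{\tau_k\}_{k\ge1}$ be a nonuniform mesh satisfying $$\rho_k\ge \eta\ \ (k\ge 2),\qquad \varepsilon\le \min_{k\ge1}\frac{1}{5(1-\alpha)(\sigma\tau_k)^\alpha},\qquad \Delta t\le \min_{k\ge2}\sigma\tau_k,\qquad T_{\rm soe}\ge\max_{k\ge2}(\sigma\tau_{k+1}+\tau_k),$$ where $\rho_k=\tau_k/\tau_{k-1}$ and $\eta\approx0.475329$ is the unique positive root of $1-3\rho^2(1+\rho)=0$. Then for any function $u$ defined on $[0,\infty)\times\Omega$ (with $u^k:=u(t_k,\cdot)\in L^2(\Omega)$ for all $k\ge 0$) and any $n\ge1$, $$\mathcal B_n(u,u):=\sum_{k=1}^n\langle F_k^{\alpha,*}u,\delta_ku\rangle\ \ge\ \sum_{k=1}^n\frac{[\mathbf B]_{kk}}{\Gamma(1-\alpha)}\|\delta_ku\|^2\ \ge\ 0,$$ where $F_k^{\alpha,*}$ is the fast L2-1$_\sigma$ operator and $[\mathbf B]_{kk}$ are the numbers defined in the context.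
   Context: $\langle\cdot,\cdot\rangle$ and $\|\cdot\|$ are the $L^2(\Omega)$ inner product and norm (real-valued functions), with $\Omega\subset\mathbb R^d$ a bounded Lipschitz domain. Mesh: $0=t_0<t_1<t_2<\cdots$, $\tau_k=t_k-t_{k-1}$ ($k\ge1$), $t_k^*=t_{k-1}+\sigma\tau_k$ with $\sigma=1-\alpha/2$. For a sequence $u^0,u^1,\dots$, $\delta_ku=u^k-u^{k-1}$. A minimum (resp. maximum) over infinitely many $k$ in a condition means that the inequality holds for every such $k$. SOE approximation: $N_q\ge 1$ is an integer and $\theta^\ell>0$, $\varpi^\ell>0$ ($1\le\ell\le N_q$) are fixed numbers such that $\big|t^{-\alpha}-\sum_{\ell=1}^{N_q}\varpi^\ell e^{-\theta^\ell t}\big|\le\varepsilon$ for all $t\in[\Delta t,T_{\rm soe}]$ (it is a known result that such numbers exist). $T_{\rm soe}$ is not required to bound the times $t_k$. Coefficients: for $1\le j\le k-1$, $$\hat a_j^{(k)}=\int_{t_{j-1}}^{t_j}\frac{2s-t_j-t_{j+1}}{\tau_j(\tau_j+\tau_{j+1})}\sum_{\ell=1}^{N_q}\varpi^\ell e^{-\theta^\ell(t_k^*-s)}\,ds,\qquad \hat c_j^{(k)}=\int_{t_{j-1}}^{t_j}\frac{2s-t_{j-1}-t_j}{\tau_{j+1}(\tau_j+\tau_{j+1})}\sum_{\ell=1}^{N_q}\varpi^\ell e^{-\theta^\ell(t_k^*-s)}\,ds,$$ $\hat c_0^{(k)}=0$, and $\hat d_j^{(k)}=\hat c_{j-1}^{(k)}-\hat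 a_j^{(k)}$. Fast L2-1$_\sigma$ operator ($k\ge1$): $$F_k^{\alpha,*}u=\frac1{\Gamma(1-\alpha)}\Big(\hat c_{k-1}^{(k)}\delta_ku+\sum_{j=1}^{k-1}\hat d_j^{(k)}\delta_ju\Big)+\frac{\sigma^{1-\alpha}}{\Gamma(2-\alpha)\tau_k^\alpha}\delta_ku.$$ The numbers $[\mathbf B]_{kk}$: put $2\beta_1=\hat d_1^{(2)}$ and $2\beta_k=\hat d_k^{(k+1)}+\hat d_{k-1}^{(k)}-\hat d_{k-1}^{(k+1)}$ for $k\ge2$. Then $$[\mathbf B]_{11}=\frac{\sigma^{1-\alpha}}{(1-\alpha)\tau_1^\alpha}-\beta_1,\qquad [\mathbf B]_{kk}=\frac{\sigma^{1-\alpha}}{(1-\alpha)\tau_k^\alpha}+\hat c_{k-1}^{(k)}-\beta_k\quad(k\ge2).$$ *)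

theory Defs
  imports "HOL-Analysis.Analysis"
begin

section \<open>Bounded Lipschitz domains and \<open>L\<^sup>2\<close>\<close>

text \<open>
  Near each boundary point the set is, in suitable orthonormal coordinates, the strict epigraph
  of a Lipschitz function. The unit vector \<open>e\<close> is the vertical direction, the hyperplane
  orthogonal to \<open>e\<close> carries the horizontal coordinates, and \<open>x - (x \<bullet> e) *\<^sub>R e\<close> is the
  horizontal part of \<open>x\<close>.
\<close>

definition bounded_lipschitz_domain :: "'a::euclidean_space set \<Rightarrow> bool" where
  "bounded_lipschitz_domain \<Omega> \<longleftrightarrow>
     open \<Omega> \<and> connected \<Omega> \<and> \<Omega> \<noteq> {} \<and> bounded \<Omega> \<and>
     (\<forall>p \<in> frontier \<Omega>. \<exists>r>0. \<exists>e. norm e = 1 \<and>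
        (\<exists>g :: 'a \<Rightarrow> real. \<exists>L. L-lipschitz_on {y. y \<bullet> e = 0} g \<and>
           \<Omega> \<inter> ball p r = {x \<in> ball p r. g (x - (x \<bullet> e) *\<^sub>R e) < x \<bullet> e}))"

definition in_L2 :: "'a::euclidean_space set \<Rightarrow> ('a \<Rightarrow> real) \<Rightarrow> bool" where
  "in_L2 \<Omega> f \<longleftrightarrow>
     f \<in> borel_measurable (lebesgue_on \<Omega>) \<and> integrable (lebesgue_on \<Omega>) (\<lambda>x. (f x)\<^sup>2)"

definition L2_inner :: "'a::euclidean_space set \<Rightarrow> ('a \<Rightarrow> real) \<Rightarrow> ('a \<Rightarrow> real) \<Rightarrow> real" where
  "L2_inner \<Omega> f g = integral\<^sup>L (lebesgue_on \<Omega>) (\<lambda>x. f x * g x)"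

definition L2_norm :: "'a::euclidean_space set \<Rightarrow> ('a \<Rightarrow> real) \<Rightarrow> real" where
  "L2_norm \<Omega> f = sqrt (L2_inner \<Omega> f f)"

section \<open>Mesh\<close>

definition is_mesh :: "(nat \<Rightarrow> real) \<Rightarrow> bool" where
  "is_mesh t \<longleftrightarrow> t 0 = 0 \<and> strict_mono t"

text \<open>The following three are meant for indices \<open>k \<ge> 1\<close>, and \<open>step_ratio\<close> for \<open>k \<ge> 2\<close>.\<close>

definition step :: "(nat \<Rightarrow> real) \<Rightarrow> nat \<Rightarrow> real" where
  "step t k = t k - t (k - 1)"

definition sigma_of :: "real \<Rightarrow> real" where
  "sigma_of \<alpha> = 1 - \<alpha> / 2"

definition tstar :: "real \<Rightarrow> (nat \<Rightarrow> real) \<Rightarrow> nat \<Rightarrow> real" where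
  "tstar \<alpha> t k = t (k - 1) + sigma_of \<alpha> * step t k"

definition step_ratio :: "(nat \<Rightarrow> real) \<Rightarrow> nat \<Rightarrow> real" where
  "step_ratio t k = step t k / step t (k - 1)"

definition \<delta> :: "(nat \<Rightarrow> real) \<Rightarrow> (real \<Rightarrow> 'a \<Rightarrow> real) \<Rightarrow> nat \<Rightarrow> 'a \<Rightarrow> real" where
  "\<delta> t u k = (\<lambda>x. u (t k) x - u (t (k - 1)) x)"

definition eta :: real where
  "eta = (THE \<rho>. \<rho> > 0 \<and> 1 - 3 * \<rho>\<^sup>2 * (1 + \<rho>) = 0)"

lemma eta_cubic_ex1: "\<exists>!\<rho>::real. \<rho> > 0 \<and> 1 - 3 * \<rho>\<^sup>2 * (1 + \<rho>) = 0"
proof -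
  let ?f = "\<lambda>x::real. 3 * x\<^sup>2 * (1 + x)"
  have "\<exists>x\<ge>0. x \<le> 1 \<and> ?f x = 1"
    by (rule IVT') (auto intro!: continuous_intros)
  then obtain x where x: "0 \<le> x" "?f x = 1" by blast
  then have x0: "x > 0" by (cases "x = 0") auto
  have mono: "?f a < ?f b" if "0 < a" "a < b" for a b :: real
  proof -
    have "a\<^sup>2 < b\<^sup>2" using that by (intro power_strict_mono) auto
    then show ?thesis using that by - (rule mult_strict_mono, simp_all)
  qed
  have "y = x" if y: "y > 0" "?f y = 1" for y
  proof (cases x y rule: linorder_cases)
    case less
    from mono[OF x0 less] show ?thesis unfolding x(2) y(2) by simp
  next
    case greater
    from mono[OF y(1) greater] show ?thesis unfolding x(2) y(2) by simp
  qed simp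
  moreover have "1 - ?f y = 0 \<longleftrightarrow> ?f y = 1" for y :: real
    by linarith
  ultimately show ?thesis using x(2) x0 by metis
qed

lemma eta_pos: "eta > 0" and eta_root: "1 - 3 * eta\<^sup>2 * (1 + eta) = 0"
  using theI'[OF eta_cubic_ex1] unfolding eta_def by auto

section \<open>Sum-of-exponentials approximation\<close>

definition soe :: "nat \<Rightarrow> (nat \<Rightarrow> real) \<Rightarrow> (nat \<Rightarrow> real) \<Rightarrow> real \<Rightarrow> real" where
  "soe Nq \<theta> w s = (\<Sum>l = 1..Nq. w l * exp (- \<theta> l * s))"

definition is_soe_approx ::
    "real \<Rightarrow> real \<Rightarrow> real \<Rightarrow> real \<Rightarrow> nat \<Rightarrow> (nat \<Rightarrow> real) \<Rightarrow> (nat \<Rightarrow> real) \<Rightarrow> bool" where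
  "is_soe_approx \<alpha> \<epsilon> \<Delta>t T Nq \<theta> w \<longleftrightarrow>
     Nq \<ge> 1 \<and> (\<forall>l \<in> {1..Nq}. \<theta> l > 0 \<and> w l > 0) \<and>
     (\<forall>s \<in> {\<Delta>t..T}. \<bar>s powr (- \<alpha>) - soe Nq \<theta> w s\<bar> \<le> \<epsilon>)"

section \<open>Coefficients of the fast L2-1\<open>\<^sub>\<sigma>\<close> operator\<close>

text \<open>
  The superscript \<open>k\<close> comes before the subscript \<open>j\<close>: the number written
  \<open>a\<^sub>j\<close> with superscript \<open>(k)\<close> (and a hat) is \<open>a_hat \<alpha> Nq \<theta> w t k j\<close>, meant for
  \<open>1 \<le> j \<le> k - 1\<close>.
\<close>

definition a_hat ::
    "real \<Rightarrow> nat \<Rightarrow> (nat \<Rightarrow> real) \<Rightarrow> (nat \<Rightarrow> real) \<Rightarrow> (nat \<Rightarrow> real) \<Rightarrow> nat \<Rightarrow> nat \<Rightarrow> real" where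
  "a_hat \<alpha> Nq \<theta> w t k j =
     integral {t (j - 1)..t j} (\<lambda>s.
       (2 * s - t j - t (j + 1)) / (step t j * (step t j + step t (j + 1)))
       * soe Nq \<theta> w (tstar \<alpha> t k - s))"

definition c_hat ::
    "real \<Rightarrow> nat \<Rightarrow> (nat \<Rightarrow> real) \<Rightarrow> (nat \<Rightarrow> real) \<Rightarrow> (nat \<Rightarrow> real) \<Rightarrow> nat \<Rightarrow> nat \<Rightarrow> real" where
  "c_hat \<alpha> Nq \<theta> w t k j =
     (if j = 0 then 0
      else integral {t (j - 1)..t j} (\<lambda>s.
        (2 * s - t (j - 1) - t j) / (step t (j + 1) * (step t j + step t (j + 1)))
        * soe Nq \<theta> w (tstar \<alpha> t k - s)))"

definition d_hat ::
    "real \<Rightarrow> nat \<Rightarrow> (nat \<Rightarrow> real) \<Rightarrow> (nat \<Rightarrow> real) \<Rightarrow> (nat \<Rightarrow> real) \<Rightarrow> nat \<Rightarrow> nat \<Rightarrow> real" where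
  "d_hat \<alpha> Nq \<theta> w t k j = c_hat \<alpha> Nq \<theta> w t k (j - 1) - a_hat \<alpha> Nq \<theta> w t k j"

definition F_op ::
    "real \<Rightarrow> nat \<Rightarrow> (nat \<Rightarrow> real) \<Rightarrow> (nat \<Rightarrow> real) \<Rightarrow> (nat \<Rightarrow> real) \<Rightarrow>
     (real \<Rightarrow> 'a \<Rightarrow> real) \<Rightarrow> nat \<Rightarrow> 'a \<Rightarrow> real" where
  "F_op \<alpha> Nq \<theta> w t u k = (\<lambda>x.
     1 / Gamma (1 - \<alpha>) *
       (c_hat \<alpha> Nq \<theta> w t k (k - 1) * \<delta> t u k x
        + (\<Sum>j = 1..k - 1. d_hat \<alpha> Nq \<theta> w t k j * \<delta> t u j x))
     + sigma_of \<alpha> powr (1 - \<alpha>) / (Gamma (2 - \<alpha>) * step t k powr \<alpha>) * \<delta> t u k x)"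

definition B_form ::
    "'a::euclidean_space set \<Rightarrow> real \<Rightarrow> nat \<Rightarrow> (nat \<Rightarrow> real) \<Rightarrow> (nat \<Rightarrow> real) \<Rightarrow> (nat \<Rightarrow> real) \<Rightarrow>
     nat \<Rightarrow> (real \<Rightarrow> 'a \<Rightarrow> real) \<Rightarrow> (real \<Rightarrow> 'a \<Rightarrow> real) \<Rightarrow> real" where
  "B_form \<Omega> \<alpha> Nq \<theta> w t n u v =
     (\<Sum>k = 1..n. L2_inner \<Omega> (F_op \<alpha> Nq \<theta> w t u k) (\<delta> t v k))"

definition beta ::
    "real \<Rightarrow> nat \<Rightarrow> (nat \<Rightarrow> real) \<Rightarrow> (nat \<Rightarrow> real) \<Rightarrow> (nat \<Rightarrow> real) \<Rightarrow> nat \<Rightarrow> real" where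
  "beta \<alpha> Nq \<theta> w t k =
     (if k = 1 then d_hat \<alpha> Nq \<theta> w t 2 1 / 2
      else (d_hat \<alpha> Nq \<theta> w t (k + 1) k + d_hat \<alpha> Nq \<theta> w t k (k - 1)
            - d_hat \<alpha> Nq \<theta> w t (k + 1) (k - 1)) / 2)"

definition B_diag ::
    "real \<Rightarrow> nat \<Rightarrow> (nat \<Rightarrow> real) \<Rightarrow> (nat \<Rightarrow> real) \<Rightarrow> (nat \<Rightarrow> real) \<Rightarrow> nat \<Rightarrow> real" where
  "B_diag \<alpha> Nq \<theta> w t k =
     (if k = 1
      then sigma_of \<alpha> powr (1 - \<alpha>) / ((1 - \<alpha>) * step t 1 powr \<alpha>) - beta \<alpha> Nq \<theta> w t 1
      else sigma_of \<alpha> powr (1 - \<alpha>) / ((1 - \<alpha>) * step t k powr \<alpha>)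
           + c_hat \<alpha> Nq \<theta> w t k (k - 1) - beta \<alpha> Nq \<theta> w t k)"

end

theory Submission
  imports Defs
begin

text \<open>
  The idea is to diagonalise the kernel. A sum of exponentials splits every coefficient \<open>d_hat\<close>
  into modes \<open>w * exp (- \<theta> * tstar k) * g j\<close>, a product of a function of the upper index and a
  function of the lower one. After the term with \<open>B_diag\<close> is removed from the form, each mode leaves
  a symmetric matrix with off-diagonal entries \<open>g j * h k\<close> (\<open>j < k\<close>), where \<open>h\<close> is positive and
  decreasing. If \<open>g\<close> is nonnegative and increasing, summation by parts exhibits this
  form as a nonnegative combination of squares of \<open>x p + \<dots> + x q\<close>
  (\<open>separable_form_lower_bound\<close>).

  That \<open>g\<close> increases follows from an interlacing that is stronger than monotonicity,
  \<open>exp (\<theta> * t (j-1)) \<le> g j \<le> exp (\<theta> * t j)\<close> (\<open>g_mode_lower\<close>, \<open>g_mode_upper\<close>). The upper half is the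
  place where the step ratios enter: it holds for all \<open>\<theta>\<close> because \<open>1 \<le> 3 * \<rho>\<^sup>2 * (1 + \<rho>)\<close>.

  The interlacing also gives the nonnegativity of \<open>B_diag\<close>. Summed over the modes, its
  upper half bounds \<open>2 * beta\<close> at indices \<open>k \<ge> 2\<close> by
  \<open>S (\<sigma> * \<tau>') + S (\<sigma> * \<tau>) - S (\<tau> + \<sigma> * \<tau>')\<close>, where \<open>S\<close> is the sum of exponentials and \<open>\<tau>\<close>, \<open>\<tau>'\<close> are
  consecutive steps. Replacing \<open>S\<close> by the power it approximates costs \<open>3 * \<epsilon>\<close>, and
  the comparison with the leading coefficient reduces to an inequality in \<open>\<alpha>\<close> and \<open>\<tau>' / \<tau>\<close>
  alone (\<open>kernel_gap_le\<close>).

  The lower bound for the form holds pointwise in space and is then integrated over \<open>\<Omega>\<close>.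
\<close>

section \<open>Quadratic forms with separable kernels\<close>

text \<open>
  With the telescoping weights \<open>g p - g (p-1) \<ge> 0\<close> the partial sum
  \<open>\<Sum>j\<le>k. g j * x j\<close> becomes \<open>\<Sum>p\<le>k. (g p - g (p-1)) * (x p + \<dots> + x k)\<close>. Writing
  \<open>V k = \<Sum>p\<le>k. (g p - g (p-1)) * (x p + \<dots> + x k)\<^sup>2\<close>, the \<open>k\<close>-th row of the form equals
  \<open>h k * (V k - V (k-1))\<close> up to a multiple of \<open>(x k)\<^sup>2\<close>, and the diagonal entry is the one for
  which summation by parts leaves
  \<open>(h k - h (k+1)) * (V k - (g k - g (k-1)) * (x k)\<^sup>2) \<ge> 0\<close> as the only remainder. Keeping
  \<open>h (n+1) * V n\<close> as the lower bound, instead of \<open>0\<close>, is what makes the induction close.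
\<close>

lemma separable_form_lower_bound:
  fixes g h x :: "nat \<Rightarrow> real"
  assumes g0: "g 0 = 0" and g: "\<And>j. g j \<le> g (Suc j)"
    and h: "\<And>k. h (Suc k) \<le> h k"
  shows "h (Suc n) * (\<Sum>p=1..n. (g p - g (p-1)) * (\<Sum>j=p..n. x j)\<^sup>2)
     \<le> (\<Sum>k=1..n. (g k * h (Suc k) + g (k-1) * h k - g (k-1) * h (Suc k)) * (x k)\<^sup>2
            + 2 * (\<Sum>j=1..k-1. g j * h k * x j) * x k)"
proof (induction n)
  case 0 show ?case by simp
next
  case (Suc n)
  define V where "V m = (\<Sum>p=1..m. (g p - g (p-1)) * (\<Sum>j=p..m. x j)\<^sup>2)" for m
  define Q where "Q m = (\<Sum>k=1..m. (g k * h (Suc k) + g (k-1) * h k - g (k-1) * h (Suc k)) * (x k)\<^sup>2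
            + 2 * (\<Sum>j=1..k-1. g j * h k * x j) * x k)" for m
  let ?X = "x (Suc n)" and ?D = "g (Suc n) - g n"
  have tele: "(\<Sum>p=1..m. g p - g (p-1)) = g m" for m by (induction m) (auto simp: g0)
  have abel: "(\<Sum>p=1..m. (g p - g (p-1)) * (\<Sum>j=p..m. x j)) = (\<Sum>j=1..m. g j * x j)" for m
  proof (induction m)
    case (Suc m)
    have "(\<Sum>p=1..m. (g p - g (p-1)) * (\<Sum>j=p..Suc m. x j))
        = (\<Sum>p=1..m. (g p - g (p-1)) * (\<Sum>j=p..m. x j) + (g p - g (p-1)) * x (Suc m))"
      by (rule sum.cong) (auto simp: distrib_left)
    also have "\<dots> = (\<Sum>p=1..m. (g p - g (p-1)) * (\<Sum>j=p..m. x j)) + g m * x (Suc m)"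
      unfolding sum.distrib sum_distrib_right[symmetric] tele ..
    finally have "(\<Sum>p=1..m. (g p - g (p-1)) * (\<Sum>j=p..Suc m. x j))
        = (\<Sum>p=1..m. (g p - g (p-1)) * (\<Sum>j=p..m. x j)) + g m * x (Suc m)" .
    with Suc show ?case by (simp add: algebra_simps)
  qed simp
  have "(\<Sum>p=1..n. (g p - g (p-1)) * (\<Sum>j=p..Suc n. x j)\<^sup>2)
      = (\<Sum>p=1..n. (g p - g (p-1)) * (\<Sum>j=p..n. x j)\<^sup>2
           + 2 * ?X * ((g p - g (p-1)) * (\<Sum>j=p..n. x j)) + (g p - g (p-1)) * ?X\<^sup>2)"
    by (rule sum.cong) (auto simp: power2_eq_square algebra_simps)
  also have "\<dots> = V n + 2 * ?X * (\<Sum>j=1..n. g j * x j) + g n * ?X\<^sup>2"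
    unfolding sum.distrib sum_distrib_left[symmetric] sum_distrib_right[symmetric] abel tele V_def ..
  finally have VS: "V (Suc n) = V n + 2 * ?X * (\<Sum>j=1..n. g j * x j) + g n * ?X\<^sup>2 + ?D * ?X\<^sup>2"
    by (simp add: V_def)
  have g': "g (p-1) \<le> g p" if "1 \<le> p" for p using g[of "p-1"] that by simp
  have "0 \<le> (\<Sum>p=1..n. (g p - g (p-1)) * (\<Sum>j=p..Suc n. x j)\<^sup>2)"
    using g' by (intro sum_nonneg mult_nonneg_nonneg) auto
  then have Vge: "?D * ?X\<^sup>2 \<le> V (Suc n)" by (simp add: V_def)
  have "(\<Sum>j=1..n. g j * h (Suc n) * x j) = h (Suc n) * (\<Sum>j=1..n. g j * x j)"
    unfolding sum_distrib_left by (rule sum.cong) auto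
  then have "Q (Suc n) = Q n + (g (Suc n) * h (Suc (Suc n)) + g n * h (Suc n) - g n * h (Suc (Suc n))) * ?X\<^sup>2
      + 2 * (h (Suc n) * (\<Sum>j=1..n. g j * x j)) * ?X"
    by (simp add: Q_def)
  then have QS: "Q (Suc n) = Q n + h (Suc n) * (V (Suc n) - V n - ?D * ?X\<^sup>2) + h (Suc (Suc n)) * ?D * ?X\<^sup>2"
    unfolding VS by (simp add: algebra_simps)
  have "h (Suc n) * V n \<le> Q n" using Suc.IH by (simp add: V_def Q_def)
  moreover have "0 \<le> (h (Suc n) - h (Suc (Suc n))) * (V (Suc n) - ?D * ?X\<^sup>2)"
    using h Vge by (intro mult_nonneg_nonneg) auto
  ultimately have "h (Suc (Suc n)) * V (Suc n) \<le> Q (Suc n)"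
    unfolding QS by (simp add: algebra_simps)
  then show ?case by (simp add: V_def Q_def)
qed

section \<open>A single exponential mode\<close>

text \<open>
  Twice the first moment of the exponential about the midpoint of the interval; all the
  coefficients of one mode are built from it and from the plain integral of the exponential.
\<close>

definition exp_moment :: "real \<Rightarrow> real \<Rightarrow> real \<Rightarrow> real" where
  "exp_moment \<theta> a b = integral {a..b} (\<lambda>s. (2 * s - a - b) * exp (\<theta> * s))"

lemma exp_tangent_bounds:
  assumes "r \<le> (s::real)"  "0 \<le> \<theta>"
  shows "\<theta> * exp (\<theta> * r) * (s - r) \<le> exp (\<theta> * s) - exp (\<theta> * r)"
    and "exp (\<theta> * s) - exp (\<theta> * r) \<le> \<theta> * exp (\<theta> * s) * (s - r)"
proof -
  have "exp (\<theta> * r) * (1 + \<theta> * (s - r)) \<le> exp (\<theta> * r) * exp (\<theta> * (s - r))"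
    by (intro mult_left_mono exp_ge_add_one_self) auto
  then show "\<theta> * exp (\<theta> * r) * (s - r) \<le> exp (\<theta> * s) - exp (\<theta> * r)"
    by (simp add: algebra_simps flip: exp_add)
  have "exp (\<theta> * s) * (1 + \<theta> * (r - s)) \<le> exp (\<theta> * s) * exp (\<theta> * (r - s))"
    by (intro mult_left_mono exp_ge_add_one_self) auto
  then show "exp (\<theta> * s) - exp (\<theta> * r) \<le> \<theta> * exp (\<theta> * s) * (s - r)"
    by (simp add: algebra_simps flip: exp_add)
qed

text \<open>
  The weight \<open>2 * s - a - b\<close> is odd about the midpoint \<open>m\<close>, so it integrates constants to \<open>0\<close>.
  As the exponential increases with slope between \<open>0\<close> and \<open>\<theta> * exp (\<theta> * b)\<close>, replacing it by the
  constant \<open>exp (\<theta> * m)\<close>, or by the line of the maximal slope through its midpoint value, changes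
  the integrand in the same direction on both sides of \<open>m\<close>.
\<close>

lemma exp_moment_bounds:
  assumes ab: "a \<le> b" and th: "0 \<le> \<theta>"
  shows "0 \<le> exp_moment \<theta> a b" and "exp_moment \<theta> a b \<le> \<theta> * exp (\<theta> * b) * (b - a) ^ 3 / 6"
proof -
  define m where "m = (a + b) / 2"
  have I: "((\<lambda>s. (2 * s - a - b) * (E + F * (s - m))) has_integral F * (b - a) ^ 3 / 6) {a..b}" for E F
  proof -
    have "((\<lambda>s. (2 * s - a - b) * (E + F * (s - m))) has_integral
       (E * (b - m)\<^sup>2 + F * 2/3 * (b - m)^3) - (E * (a - m)\<^sup>2 + F * 2/3 * (a - m)^3)) {a..b}"
      by (rule fundamental_theorem_of_calculus[OF ab], unfold has_real_derivative_iff_has_vector_derivative[symmetric])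
         (auto intro!: derivative_eq_intros simp: m_def power2_eq_square field_simps)
    also have "(E * (b - m)\<^sup>2 + F * 2/3 * (b - m)^3) - (E * (a - m)\<^sup>2 + F * 2/3 * (a - m)^3) = F * (b - a) ^ 3 / 6"
      by (simp add: m_def field_simps power2_eq_square power3_eq_cube)
    finally show ?thesis .
  qed
  have J: "((\<lambda>s. (2 * s - a - b) * exp (\<theta> * s)) has_integral exp_moment \<theta> a b) {a..b}"
    unfolding exp_moment_def
    by (intro integrable_integral integrable_continuous_real continuous_intros)
  show "0 \<le> exp_moment \<theta> a b"
  proof (rule has_integral_le[OF I[of "exp (\<theta> * m)" 0, simplified] J])
    fix s assume "s \<in> {a..b}"
    show "(2 * s - a - b) * exp (\<theta> * m) \<le> (2 * s - a - b) * exp (\<theta> * s)"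
    proof (cases "m \<le> s")
      case True
      then have "\<theta> * m \<le> \<theta> * s" using th by (rule mult_left_mono)
      then show ?thesis using True by (intro mult_left_mono) (auto simp: m_def)
    next
      case False
      then have "\<theta> * s \<le> \<theta> * m" using th by (intro mult_left_mono) auto
      then show ?thesis using False by (intro mult_left_mono_neg) (auto simp: m_def)
    qed
  qed
  show "exp_moment \<theta> a b \<le> \<theta> * exp (\<theta> * b) * (b - a) ^ 3 / 6"
  proof (rule has_integral_le[OF J I[of "exp (\<theta> * m)" "\<theta> * exp (\<theta> * b)"]])
    fix s assume s: "s \<in> {a..b}"
    have *: "\<theta> * exp (\<theta> * q) * d \<le> \<theta> * exp (\<theta> * b) * d" if "q \<le> b" "0 \<le> d" for q d
      using that th by (intro mult_right_mono mult_left_mono) (auto simp: mult_left_mono)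
    show "(2 * s - a - b) * exp (\<theta> * s) \<le> (2 * s - a - b) * (exp (\<theta> * m) + \<theta> * exp (\<theta> * b) * (s - m))"
    proof (cases "m \<le> s")
      case True
      then show ?thesis using exp_tangent_bounds(2)[OF True th] *[of s "s - m"] s
        by (intro mult_left_mono) (auto simp: m_def)
    next
      case False
      then have "exp (\<theta> * m) - exp (\<theta> * s) \<le> \<theta> * exp (\<theta> * b) * (m - s)"
        using exp_tangent_bounds(2)[of s m \<theta>] th *[of m "m - s"] s by (auto simp: m_def)
      then have "exp (\<theta> * m) + \<theta> * exp (\<theta> * b) * (s - m) \<le> exp (\<theta> * s)"
        by (simp add: algebra_simps)
      then show ?thesis using False by (intro mult_left_mono_neg) (auto simp: m_def)
    qed
  qed
qed

lemma exp_integral_le: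
  fixes a b \<theta> :: real
  assumes ab: "a \<le> b" and th: "0 \<le> \<theta>"
  shows "integral {a..b} (\<lambda>s. exp (\<theta> * s)) \<le> (b - a) * exp (\<theta> * b) - \<theta> * exp (\<theta> * a) * (b - a)\<^sup>2 / 2"
proof -
  let ?K = "\<theta> * exp (\<theta> * a)"
  have I: "((\<lambda>s. exp (\<theta> * b) - ?K * (b - s)) has_integral
       (exp (\<theta> * b) * b + ?K * (b - b)\<^sup>2/2) - (exp (\<theta> * b) * a + ?K * (b - a)\<^sup>2/2)) {a..b}"
    by (rule fundamental_theorem_of_calculus[OF ab], unfold has_real_derivative_iff_has_vector_derivative[symmetric])
       (auto intro!: derivative_eq_intros simp: power2_eq_square field_simps)
  have "integral {a..b} (\<lambda>s. exp (\<theta> * s)) \<le> (exp (\<theta> * b) * b + ?K * (b - b)\<^sup>2/2) - (exp (\<theta> * b) * a + ?K * (b - a)\<^sup>2/2)"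
  proof (rule has_integral_le[OF integrable_integral I])
    show "(\<lambda>s. exp (\<theta> * s)) integrable_on {a..b}" by (intro integrable_continuous_real continuous_intros)
    fix s assume s: "s \<in> {a..b}"
    have "?K * (b - s) \<le> \<theta> * exp (\<theta> * s) * (b - s)"
      using s th by (intro mult_right_mono mult_left_mono) (auto simp: mult_left_mono)
    with exp_tangent_bounds(1)[of s b \<theta>] th s show "exp (\<theta> * s) \<le> exp (\<theta> * b) - ?K * (b - s)" by auto
  qed
  then show ?thesis by (simp add: algebra_simps)
qed

text \<open>
  The coefficients that arise when the kernel \<open>soe\<close>, evaluated at \<open>tstar - s\<close>, is replaced by the
  single exponential \<open>exp (\<theta> * s)\<close>: \<open>c_mode\<close> and \<open>g_mode\<close> are the parts of \<open>c_hat\<close> and \<open>d_hat\<close> that depend on the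
  lower index only. The value of \<open>c_mode\<close> at \<open>0\<close> is \<open>0\<close>, because the interval degenerates to a
  point; this reproduces the convention for \<open>c_hat\<close>.
\<close>

definition c_mode :: "real \<Rightarrow> (nat \<Rightarrow> real) \<Rightarrow> nat \<Rightarrow> real" where
  "c_mode \<theta> t j = exp_moment \<theta> (t (j-1)) (t j) / (step t (j+1) * (step t j + step t (j+1)))"

definition g_mode :: "real \<Rightarrow> (nat \<Rightarrow> real) \<Rightarrow> nat \<Rightarrow> real" where
  "g_mode \<theta> t j = c_mode \<theta> t (j - 1)
     + integral {t (j-1)..t j} (\<lambda>s. (t j + t (j+1) - 2 * s) * exp (\<theta> * s)) / (step t j * (step t j + step t (j+1)))"

lemma step_pos: "is_mesh t \<Longrightarrow> 1 \<le> k \<Longrightarrow> 0 < step t k"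
  unfolding is_mesh_def step_def by (auto simp: strict_mono_def)

lemma eta_cubic_ge: assumes "eta \<le> r" shows "1 \<le> 3 * r\<^sup>2 * (1 + r)"
proof -
  have "3 * eta\<^sup>2 * (1 + eta) \<le> 3 * r\<^sup>2 * (1 + r)"
    using assms eta_pos by (intro mult_mono power_mono) auto
  with eta_root show ?thesis by linarith
qed

lemma eta_gt: "475/1000 < eta"
proof (rule ccontr)
  assume "\<not> ?thesis"
  then have "3 * eta\<^sup>2 * (1 + eta) \<le> 3 * (475/1000)\<^sup>2 * (1 + 475/1000)"
    using eta_pos by (intro mult_mono power_mono) auto
  with eta_root show False by (simp add: power2_eq_square)
qed

lemma c_mode_nonneg: assumes "is_mesh t" "0 \<le> \<theta>" shows "0 \<le> c_mode \<theta> t j"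
proof -
  have "t (j-1) \<le> t j" using assms(1) unfolding is_mesh_def by (auto simp: strict_mono_less_eq)
  moreover have "0 \<le> step t j" using step_pos[OF assms(1), of j] by (cases j) (auto simp: step_def)
  ultimately show ?thesis unfolding c_mode_def using step_pos[OF assms(1), of "j+1"] assms
    by (intro divide_nonneg_nonneg exp_moment_bounds mult_nonneg_nonneg) auto
qed

section \<open>Interlacing of the mode coefficients with the exponential\<close>

text \<open>
  Together with the upper bound below this places \<open>g_mode\<close> at \<open>j\<close> between the values of the
  exponential at the end points of the \<open>j\<close>-th interval. The integral in \<open>g_mode\<close> is an average
  of the exponential with a nonnegative weight of total mass \<open>1\<close>, and \<open>c_mode\<close> only adds to it.
\<close>

lemma g_mode_lower:
  assumes M: "is_mesh t" and th: "0 \<le> \<theta>" and j: "1 \<le> j"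
  shows "exp (\<theta> * t (j-1)) \<le> g_mode \<theta> t j"
proof -
  let ?a = "t (j-1)" and ?b = "t j" and ?c = "t (j+1)"
  have ab: "?a < ?b" "?b < ?c" using M j by (auto simp: is_mesh_def strict_mono_def)
  have I: "((\<lambda>s. (?b + ?c - 2 * s) * exp (\<theta> * ?a)) has_integral
     (((?b + ?c) * ?b - ?b\<^sup>2) * exp (\<theta> * ?a)) - (((?b + ?c) * ?a - ?a\<^sup>2) * exp (\<theta> * ?a))) {?a..?b}"
    using ab by (intro fundamental_theorem_of_calculus, simp, unfold has_real_derivative_iff_has_vector_derivative[symmetric])
       (auto intro!: derivative_eq_intros simp: power2_eq_square field_simps)
  have "(((?b + ?c) * ?b - ?b\<^sup>2) * exp (\<theta> * ?a)) - (((?b + ?c) * ?a - ?a\<^sup>2) * exp (\<theta> * ?a))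
      \<le> integral {?a..?b} (\<lambda>s. (?b + ?c - 2 * s) * exp (\<theta> * s))"
  proof (rule has_integral_le[OF I integrable_integral])
    show "(\<lambda>s. (?b + ?c - 2 * s) * exp (\<theta> * s)) integrable_on {?a..?b}"
      by (intro integrable_continuous_real continuous_intros)
    fix s assume "s \<in> {?a..?b}"
    then show "(?b + ?c - 2 * s) * exp (\<theta> * ?a) \<le> (?b + ?c - 2 * s) * exp (\<theta> * s)"
      using ab th by (intro mult_left_mono) (auto simp: mult_left_mono)
  qed
  also have "(((?b + ?c) * ?b - ?b\<^sup>2) * exp (\<theta> * ?a)) - (((?b + ?c) * ?a - ?a\<^sup>2) * exp (\<theta> * ?a))
      = exp (\<theta> * ?a) * (step t j * (step t j + step t (j+1)))"
    by (simp add: step_def power2_eq_square algebra_simps)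
  finally have "exp (\<theta> * ?a) \<le> integral {?a..?b} (\<lambda>s. (?b + ?c - 2 * s) * exp (\<theta> * s)) / (step t j * (step t j + step t (j+1)))"
    using step_pos[OF M, of j] step_pos[OF M, of "j+1"] j
    by (subst pos_le_divide_eq) (auto intro!: mult_pos_pos add_pos_pos)
  with c_mode_nonneg[OF M th, of "j-1"] show ?thesis unfolding g_mode_def by simp
qed

text \<open>
  The average over the \<open>j\<close>-th interval stays below the value at the right end by at least
  \<open>\<theta> * exp (\<theta> * t (j-1)) * \<tau>\<^sub>j / 2\<close>, whereas the contribution \<open>c_mode\<close> of the preceding interval
  is at most \<open>\<theta> * exp (\<theta> * t (j-1)) * \<tau>\<^sub>p\<^sup>3 / (6 * \<tau>\<^sub>j * (\<tau>\<^sub>p + \<tau>\<^sub>j))\<close> with \<open>p = j-1\<close>. The gain covers the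
  loss exactly when \<open>1 \<le> 3 * \<rho>\<^sup>2 * (1 + \<rho>)\<close> for the step ratio \<open>\<rho>\<close>, which is the condition
  defining \<open>eta\<close>.
\<close>

lemma g_mode_upper:
  assumes M: "is_mesh t" and th: "0 \<le> \<theta>" and j: "1 \<le> j"
    and r: "2 \<le> j \<Longrightarrow> eta \<le> step_ratio t j"
  shows "g_mode \<theta> t j \<le> exp (\<theta> * t j)"
proof -
  let ?a = "t (j-1)" and ?b = "t j" and ?c = "t (j+1)"
  let ?p = "step t (j-1)" and ?q = "step t j" and ?r = "step t (j+1)"
  have ab: "?a < ?b" "?b < ?c" using M j by (auto simp: is_mesh_def strict_mono_def)
  have q: "0 < ?q" "0 < ?r" using step_pos[OF M] j by auto
  have "integral {?a..?b} (\<lambda>s. (?b + ?c - 2 * s) * exp (\<theta> * s))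
    = integral {?a..?b} (\<lambda>s. (?q + ?r) * exp (\<theta> * s) - (2 * s - ?a - ?b) * exp (\<theta> * s))"
    by (rule integral_cong) (simp add: step_def algebra_simps)
  also have "\<dots> = (?q + ?r) * integral {?a..?b} (\<lambda>s. exp (\<theta> * s)) - exp_moment \<theta> ?a ?b"
    unfolding exp_moment_def
    by (subst integral_diff) (auto intro!: integrable_continuous_real continuous_intros)
  also have "\<dots> \<le> (?q + ?r) * (?q * exp (\<theta> * ?b) - \<theta> * exp (\<theta> * ?a) * ?q\<^sup>2 / 2)"
  proof -
    have "(?q + ?r) * integral {?a..?b} (\<lambda>s. exp (\<theta> * s))
        \<le> (?q + ?r) * (?q * exp (\<theta> * ?b) - \<theta> * exp (\<theta> * ?a) * ?q\<^sup>2 / 2)"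
      using exp_integral_le[of ?a ?b \<theta>] ab th q by (intro mult_left_mono) (auto simp: step_def)
    with exp_moment_bounds(1)[of ?a ?b \<theta>] ab th show ?thesis by simp
  qed
  also have "\<dots> = (exp (\<theta> * ?b) - \<theta> * exp (\<theta> * ?a) * ?q / 2) * (?q * (?q + ?r))"
    by (simp add: power2_eq_square algebra_simps)
  finally have A: "integral {?a..?b} (\<lambda>s. (?b + ?c - 2 * s) * exp (\<theta> * s)) / (?q * (?q + ?r))
      \<le> exp (\<theta> * ?b) - \<theta> * exp (\<theta> * ?a) * ?q / 2"
    using q by (subst pos_divide_le_eq) (auto intro!: mult_pos_pos add_pos_pos)
  have "c_mode \<theta> t (j-1) \<le> \<theta> * exp (\<theta> * ?a) * ?q / 2"
  proof (cases "j = 1")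
    case True
    then show ?thesis using th q by (simp add: c_mode_def exp_moment_def)
  next
    case False
    then have j2: "2 \<le> j" using j by simp
    have p: "0 < ?p" using step_pos[OF M, of "j-1"] j2 by simp
    have jj: "j - 1 + 1 = j" using j by simp
    have "1 \<le> 3 * (?q/?p)\<^sup>2 * (1 + ?q/?p)" using eta_cubic_ge r[OF j2] by (simp add: step_ratio_def)
    then have cubic: "?p ^ 3 \<le> 3 * ?q\<^sup>2 * (?p + ?q)" using p
      by (simp add: field_simps power2_eq_square power3_eq_cube)
    have "exp_moment \<theta> (t (j-1-1)) ?a \<le> \<theta> * exp (\<theta> * ?a) * ?p ^ 3 / 6"
      using exp_moment_bounds(2)[of "t (j-1-1)" ?a \<theta>] th p by (simp add: step_def)
    also have "\<dots> \<le> \<theta> * exp (\<theta> * ?a) * (3 * ?q\<^sup>2 * (?p + ?q)) / 6"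
      using cubic th by (intro divide_right_mono mult_left_mono) auto
    also have "\<dots> = \<theta> * exp (\<theta> * ?a) * ?q / 2 * (?q * (?p + ?q))" by (simp add: power2_eq_square)
    finally show ?thesis unfolding c_mode_def jj using p q
      by (subst pos_divide_le_eq) (auto intro!: mult_pos_pos add_pos_pos)
  qed
  with A show ?thesis unfolding g_mode_def by linarith
qed

section \<open>Expansion of the coefficients into modes\<close>

lemma integral_times_soe:
  assumes "continuous_on {a..b} p"
  shows "integral {a..b} (\<lambda>s. p s * soe Nq \<theta> w (T - s))
    = (\<Sum>l=1..Nq. w l * exp (- \<theta> l * T) * integral {a..b} (\<lambda>s. p s * exp (\<theta> l * s)))"
proof -
  have "integral {a..b} (\<lambda>s. p s * soe Nq \<theta> w (T - s))
     = integral {a..b} (\<lambda>s. \<Sum>l=1..Nq. (w l * exp (- \<theta> l * T)) * (p s * exp (\<theta> l * s)))"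
    by (rule integral_cong) (simp add: soe_def sum_distrib_left right_diff_distrib exp_diff exp_minus divide_inverse mult_ac)
  also have "\<dots> = (\<Sum>l=1..Nq. integral {a..b} (\<lambda>s. (w l * exp (- \<theta> l * T)) * (p s * exp (\<theta> l * s))))"
    using assms by (intro integral_sum) (auto intro!: integrable_continuous_real continuous_intros)
  finally show ?thesis by simp
qed

lemma c_hat_modes:
  "c_hat \<alpha> Nq \<theta> w t k j = (\<Sum>l=1..Nq. w l * exp (- \<theta> l * tstar \<alpha> t k) * c_mode (\<theta> l) t j)"
proof (cases "j = 0")
  case True then show ?thesis by (simp add: c_hat_def c_mode_def exp_moment_def)
next
  case False
  let ?D = "step t (j+1) * (step t j + step t (j+1))"
  have "integral {t (j-1)..t j} (\<lambda>s. (2 * s - t (j-1) - t j) / ?D * exp (\<theta>' * s)) = c_mode \<theta>' t j" for \<theta>'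
    unfolding c_mode_def exp_moment_def integral_divide[symmetric] by (rule integral_cong) simp
  with False show ?thesis unfolding c_hat_def
    by (subst integral_times_soe) (auto intro!: continuous_intros simp: divide_inverse)
qed

lemma d_hat_modes:
  "d_hat \<alpha> Nq \<theta> w t k j = (\<Sum>l=1..Nq. w l * exp (- \<theta> l * tstar \<alpha> t k) * g_mode (\<theta> l) t j)"
proof -
  let ?D = "step t j * (step t j + step t (j+1))"
  have "integral {t (j-1)..t j} (\<lambda>s. (2 * s - t j - t (j+1)) / ?D * exp (\<theta>' * s))
    = - (integral {t (j-1)..t j} (\<lambda>s. (t j + t (j+1) - 2 * s) * exp (\<theta>' * s)) / ?D)" for \<theta>'
  proof -
    have "integral {t (j-1)..t j} (\<lambda>s. (2 * s - t j - t (j+1)) / ?D * exp (\<theta>' * s))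
      = integral {t (j-1)..t j} (\<lambda>s. - ((t j + t (j+1) - 2 * s) * exp (\<theta>' * s) / ?D))"
      by (rule integral_cong) (simp add: divide_inverse algebra_simps)
    then show ?thesis by simp
  qed
  then have "a_hat \<alpha> Nq \<theta> w t k j = (\<Sum>l=1..Nq. w l * exp (- \<theta> l * tstar \<alpha> t k) *
      - (integral {t (j-1)..t j} (\<lambda>s. (t j + t (j+1) - 2 * s) * exp (\<theta> l * s)) / ?D))"
    unfolding a_hat_def by (subst integral_times_soe) (auto intro!: continuous_intros simp: divide_inverse)
  then show ?thesis unfolding d_hat_def c_hat_modes
    by (simp add: g_mode_def sum_negf algebra_simps flip: sum.distrib sum_subtractf)
qed

section \<open>The numerical inequality behind the diagonal bound\<close>

lemma powr_le_affine:
  fixes r a :: real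
  assumes "0 < r" "0 \<le> a" "a \<le> 1"
  shows "r powr a \<le> 1 + a * (r - 1)"
  using Youngs_inequality_0[of a "1 - a" r 1] assms by (simp add: algebra_simps)

text \<open>
  The left side decreases in \<open>r\<close>, being the product of the decreasing factors \<open>r powr (- a)\<close> and
  \<open>1 - (r / (r + c)) powr a\<close>; hence only \<open>r = 475/1000\<close> matters. There both powers are replaced
  by algebraic bounds: the first is estimated through the square of \<open>(1451/1000) powr a\<close>, since
  the affine bound applied to \<open>2.105 powr a\<close> itself is too lossy, and the second by the affine
  bound of its reciprocal. What remains is a polynomial of degree \<open>5\<close> in \<open>a\<close>, positive with a
  margin of less than \<open>1/100\<close> near \<open>a = 21/40\<close>.
\<close>

lemma kernel_gap_le:
  assumes a: "0 < a" "a < (1::real)" and r: "475/1000 \<le> r"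
  shows "(1 - a) * (r powr (- a) - (r + 1 / (1 - a/2)) powr (- a)) \<le> 2/5"
proof -
  define c where "c = 1 / (1 - a/2)"
  have c: "0 < c" using a by (simp add: c_def)
  define q :: real where "q = 475/1000"
  define Q where "Q = 2 - 5/100 * a + 525/1000 * a\<^sup>2"
  have factored: "x powr (- a) - (x + c) powr (- a) = x powr (- a) * (1 - (x / (x + c)) powr a)" if "0 < x" for x
  proof -
    have "(x / (x + c)) powr a = x powr a / (x + c) powr a"
      using that c by (simp add: powr_divide)
    then show ?thesis using that c by (simp add: powr_minus right_diff_distrib divide_inverse)
  qed
  have "r powr (- a) - (r + c) powr (- a) \<le> q powr (- a) - (q + c) powr (- a)"
  proof -
    have "q / (q + c) \<le> r / (r + c)" using r c by (simp add: q_def field_simps)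
    then have "(q / (q + c)) powr a \<le> (r / (r + c)) powr a"
      using a c by (intro powr_mono2) (auto simp: q_def)
    moreover have "r powr (- a) \<le> q powr (- a)"
      using r a by (intro powr_mono2') (auto simp: q_def)
    moreover have "(r / (r + c)) powr a \<le> 1" using r c a by (intro powr_le1) auto
    ultimately show ?thesis using r by (simp add: factored q_def) (intro mult_mono, auto)
  qed
  moreover have "q powr (- a) \<le> (1 + a * (451/1000))\<^sup>2"
  proof -
    have q: "0 < q" "1 / q \<le> 1451/1000 * (1451/1000)" by (simp_all add: q_def)
    have "q powr (- a) = (1 / q) powr a" using q(1) by (simp add: powr_minus powr_divide inverse_eq_divide)
    also have "\<dots> \<le> (1451/1000 * (1451/1000)) powr a"
      using a q by (intro powr_mono2) auto
    also have "\<dots> = ((1451/1000) powr a)\<^sup>2" unfolding power2_eq_square by (simp only: powr_mult)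
    also have "\<dots> \<le> (1 + a * (1451/1000 - 1))\<^sup>2"
      using a by (intro power_mono powr_le_affine) auto
    finally show ?thesis by simp
  qed
  moreover have "(2 - a) / Q \<le> (q + c) powr (- a)"
  proof -
    have "(q + c) powr a \<le> 1 + a * (q + c - 1)" using a c by (intro powr_le_affine) (auto simp: q_def)
    also have "\<dots> = Q / (2 - a)" using a by (simp add: Q_def c_def q_def field_simps power2_eq_square)
    finally have "1 / (Q / (2 - a)) \<le> 1 / (q + c) powr a"
      using c by (intro frac_le) (auto simp: q_def)
    then show ?thesis by (simp add: powr_minus divide_inverse mult.commute)
  qed
  ultimately have "r powr (- a) - (r + c) powr (- a) \<le> (1 + a * (451/1000))\<^sup>2 - (2 - a) / Q" by linarith
  then have "(1 - a) * (r powr (- a) - (r + c) powr (- a)) \<le> (1 - a) * ((1 + a * (451/1000))\<^sup>2 - (2 - a) / Q)"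
    using a by (intro mult_left_mono) auto
  also have "\<dots> \<le> 2/5"
  proof -
    have Q: "0 < Q" unfolding Q_def using a by (intro add_pos_nonneg) auto
    \<comment> \<open>Multiples of \<open>(a - 21/40)\<^sup>2\<close>, whose root is next to the minimum of the polynomial, certify
      its positivity as a linear combination.\<close>
    have certificate: "a ^ (i + 2) \<ge> 21/20 * a ^ (i + 1) - 441/1600 * a ^ i" for i
    proof -
      have "0 \<le> a ^ i * (a - 21/40)\<^sup>2" using a by simp
      also have "\<dots> = a ^ (i + 2) - 21/20 * a ^ (i + 1) + 441/1600 * a ^ i"
        by (simp add: power2_eq_square algebra_simps)
      finally show ?thesis by simp
    qed
    have "2/5 * Q + (1 - a) * (2 - a) - (1 - a) * (1 + a * (451/1000))\<^sup>2 * Q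
      = 4/5 - 2774/1000 * a + 2077298/1000000 * a^2 + 42332205/100000000 * a^3
        + 356594425/1000000000 * a^4 + 106785525/1000000000 * a^5"
      by (simp add: Q_def power2_eq_square power3_eq_cube power4_eq_xxxx power_numeral_odd Let_def field_simps)
    also have "\<dots> \<ge> 0"
      using certificate[of 0] certificate[of 1] certificate[of 2] certificate[of 3] a
      by (simp add: numeral_2_eq_2[symmetric])
    finally have "(1 - a) * (1 + a * (451/1000))\<^sup>2 * Q - (1 - a) * (2 - a) \<le> 2/5 * Q" by simp
    with Q show ?thesis by (simp add: field_simps)
  qed
  finally show ?thesis by (simp add: c_def)
qed

text \<open>
  The inequality between the leading coefficient and the kernel values in one row: \<open>x\<close> and \<open>y\<close>
  stand for \<open>\<sigma>\<close> times two consecutive steps, and \<open>3 * e\<close> for the errors of three evaluations of the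
  sum of exponentials. Those errors consume \<open>3/5\<close>, and the gap of the kernel \<open>2/5\<close>, of the surplus
  \<open>1 / (1 - a)\<close> that \<open>2 * (1 - a/2) / (1 - a)\<close> has over \<open>1\<close>.
\<close>

lemma leading_coefficient_dominates:
  assumes a: "0 < a" "a < (1::real)" and x: "0 < x" "475/1000 * x \<le> y" 
    and e: "e \<le> 1 / (5 * (1 - a) * x powr a)"
  shows "y powr (-a) + x powr (-a) - (x / (1 - a/2) + y) powr (-a) + 3 * e
     \<le> 2 * ((1 - a/2) / (1 - a) * x powr (-a))"
proof -
  define r c where "r = y / x" and "c = 1 / (1 - a/2)"
  define X R C where "X = x powr (-a)" and "R = r powr (-a)" and "C = (r + c) powr (-a)"
  have "475/1000 \<le> r" using x by (simp add: r_def pos_le_divide_eq)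
  then have "(1 - a) * (R - C) \<le> 2/5"
    unfolding R_def C_def c_def by (rule kernel_gap_le[OF a])
  then have "R - C \<le> 2/5 / (1 - a)"
    using a by (subst pos_le_divide_eq) (simp_all add: mult.commute[of "R - C"])
  then have "X * (R - C) \<le> X * (2/5 / (1 - a))"
    by (intro mult_left_mono) (auto simp: X_def)
  then have "X * R - X * C \<le> X * (2/5 / (1 - a))" by (simp only: right_diff_distrib)
  moreover have "X * R = y powr (-a)"
  proof -
    have "x * r = y" using x by (simp add: r_def)
    then show ?thesis by (simp only: X_def R_def powr_mult[symmetric])
  qed
  moreover have "X * C = (x / (1 - a/2) + y) powr (-a)"
  proof -
    have "x * (r + c) = x / (1 - a/2) + y" using x by (simp add: r_def c_def distrib_left)
    then show ?thesis by (simp only: X_def C_def powr_mult[symmetric])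
  qed
  moreover have "3 * e \<le> 3 * (X * (1/5 / (1 - a)))"
  proof -
    have "1 / (5 * (1 - a) * x powr a) = X * (1/5 / (1 - a))"
      unfolding X_def powr_minus_divide by (simp only: times_divide_times_eq divide_divide_eq_left mult_1 mult.commute[of "x powr a"])
    with e show ?thesis by linarith
  qed
  moreover have "2 * ((1 - a/2) / (1 - a) * X) = X * (2/5 / (1 - a)) + 3 * (X * (1/5 / (1 - a))) + X"
  proof -
    have "2/5 / (1 - a) + 3 * (1/5 / (1 - a)) = 1 / (1 - a)"
      unfolding divide_inverse[of _ "1 - a"] by linarith
    moreover have "2 * ((1 - a/2) / (1 - a)) = 1 / (1 - a) + 1"
    proof -
      have "2 * ((1 - a/2) / (1 - a)) = (1 + (1 - a)) / (1 - a)" by simp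
      also have "\<dots> = 1 / (1 - a) + 1" using a by (subst add_divide_distrib) simp
      finally show ?thesis .
    qed
    ultimately have "X * (2 * ((1 - a/2) / (1 - a))) = X * (2/5 / (1 - a) + 3 * (1/5 / (1 - a)) + 1)"
      by simp
    then show ?thesis by (simp add: ring_distribs mult_ac)
  qed
  ultimately show ?thesis unfolding X_def[symmetric] by linarith
qed

section \<open>Bounds for the coefficients\<close>

lemma tstar_offsets:
  shows "tstar \<alpha> t (k+1) - t k = sigma_of \<alpha> * step t (k+1)"
    and "tstar \<alpha> t k - t (k-1) = sigma_of \<alpha> * step t k"
    and "tstar \<alpha> t (k+1) - t (k-1) = step t k + sigma_of \<alpha> * step t (k+1)"
  by (simp_all add: tstar_def step_def)

lemma tstar_mono:
  assumes M: "is_mesh t" and a: "0 < \<alpha>" "\<alpha> < 1"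
  shows "tstar \<alpha> t k \<le> tstar \<alpha> t (Suc k)"
proof -
  have "t (k-1) \<le> t k" "t k \<le> t (Suc k)" using M unfolding is_mesh_def by (auto simp: strict_mono_less_eq)
  then have "sigma_of \<alpha> * step t k \<le> 1 * step t k" "0 \<le> sigma_of \<alpha> * step t (Suc k)"
    using a unfolding sigma_of_def step_def by (intro mult_right_mono mult_nonneg_nonneg; simp)+
  then show ?thesis by (simp add: tstar_def step_def)
qed

lemma soe_eq_modes: "soe Nq \<theta> w (T - s) = (\<Sum>l=1..Nq. w l * exp (- \<theta> l * T) * exp (\<theta> l * s))"
  by (simp add: soe_def right_diff_distrib exp_diff exp_minus divide_inverse mult_ac)

text \<open>
  Bounding \<open>g_mode\<close> by the exponential at \<open>t j\<close> mode by mode and summing up again gives a single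
  value of the kernel, so that comparing with the power will cost only one \<open>\<epsilon>\<close>.
\<close>

lemma d_hat_le_soe:
  assumes M: "is_mesh t" and pos: "\<forall>l \<in> {1..Nq}. 0 \<le> \<theta> l \<and> 0 \<le> w l"
    and j: "1 \<le> j" and r: "2 \<le> j \<Longrightarrow> eta \<le> step_ratio t j"
  shows "d_hat \<alpha> Nq \<theta> w t k j \<le> soe Nq \<theta> w (tstar \<alpha> t k - t j)"
  unfolding d_hat_modes soe_eq_modes
  using pos by (intro sum_mono mult_left_mono g_mode_upper M j r) auto

text \<open>
  In each mode the difference is \<open>g_mode\<close> times a decrement of \<open>exp (- \<theta> * tstar)\<close>, which is
  nonnegative, so the upper bound for \<open>g_mode\<close> applies to the difference as well. Bounding the two
  coefficients separately would not use that they nearly cancel.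
\<close>

lemma d_hat_decay_le_soe:
  assumes M: "is_mesh t" and pos: "\<forall>l \<in> {1..Nq}. 0 \<le> \<theta> l \<and> 0 \<le> w l"
    and a: "0 < \<alpha>" "\<alpha> < 1"
    and j: "1 \<le> j" and r: "2 \<le> j \<Longrightarrow> eta \<le> step_ratio t j"
  shows "d_hat \<alpha> Nq \<theta> w t k j - d_hat \<alpha> Nq \<theta> w t (k+1) j
    \<le> soe Nq \<theta> w (tstar \<alpha> t k - t j) - soe Nq \<theta> w (tstar \<alpha> t (k+1) - t j)"
  unfolding d_hat_modes soe_eq_modes sum_subtractf[symmetric] left_diff_distrib[symmetric]
  using pos tstar_mono[OF M a, of k]
  by (intro sum_mono mult_left_mono g_mode_upper M j r) (auto intro!: mult_left_mono)

lemma c_hat_nonneg: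
  assumes "is_mesh t" "\<forall>l \<in> {1..Nq}. 0 \<le> \<theta> l \<and> 0 \<le> w l"
  shows "0 \<le> c_hat \<alpha> Nq \<theta> w t k j"
  unfolding c_hat_modes using assms by (intro sum_nonneg mult_nonneg_nonneg c_mode_nonneg) auto

lemma g_mode_0: "g_mode \<theta> t 0 = 0"
  by (simp add: g_mode_def c_mode_def exp_moment_def)

text \<open>
  Since \<open>d_hat\<close> vanishes at index \<open>0\<close>, the defining formula for \<open>k \<ge> 2\<close> extends to \<open>k = 1\<close>.
\<close>

lemma twice_beta:
  assumes "1 \<le> k"
  shows "2 * beta \<alpha> Nq \<theta> w t k = d_hat \<alpha> Nq \<theta> w t (k+1) k + d_hat \<alpha> Nq \<theta> w t k (k-1)
            - d_hat \<alpha> Nq \<theta> w t (k+1) (k-1)"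
proof -
  have "d_hat \<alpha> Nq \<theta> w t k 0 = 0" for k by (simp add: d_hat_modes g_mode_0)
  then show ?thesis by (auto simp: beta_def numeral_2_eq_2)
qed

section \<open>The two inequalities for the quadratic form\<close>

text \<open>
  In the mode \<open>l\<close>, \<open>d_hat\<close> factors as \<open>g j * h k\<close> with \<open>h k = exp (- \<theta> l * tstar k)\<close> decreasing and,
  by the interlacing, \<open>g\<close> nonnegative and increasing; \<open>beta\<close> is exactly the diagonal required by
  the lemma on separable kernels. The form is the combination of the modes with the weights
  \<open>w l \<ge> 0\<close>.
\<close>

lemma beta_form_nonneg:
  fixes y :: "nat \<Rightarrow> real"
  assumes M: "is_mesh t" and pos: "\<forall>l \<in> {1..Nq}. 0 \<le> \<theta> l \<and> 0 \<le> w l"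
    and a: "0 < \<alpha>" "\<alpha> < 1"
    and r: "\<And>k. k \<ge> 2 \<Longrightarrow> step_ratio t k \<ge> eta"
  shows "0 \<le> (\<Sum>k=1..n. beta \<alpha> Nq \<theta> w t k * (y k)\<^sup>2 + (\<Sum>j=1..k-1. d_hat \<alpha> Nq \<theta> w t k j * y j) * y k)"
proof -
  define h where "h l k = exp (- \<theta> l * tstar \<alpha> t k)" for l k
  define g where "g l = g_mode (\<theta> l) t" for l
  define Q where "Q l k = (g l k * h l (Suc k) + g l (k-1) * h l k - g l (k-1) * h l (Suc k)) * (y k)\<^sup>2
            + 2 * (\<Sum>j=1..k-1. g l j * h l k * y j) * y k" for l k
  have d: "d_hat \<alpha> Nq \<theta> w t k j = (\<Sum>l=1..Nq. w l * (g l j * h l k))" for k j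
    by (simp add: d_hat_modes g_def h_def mult_ac)
  have step_l: "0 \<le> (\<Sum>k=1..n. Q l k)" if l: "l \<in> {1..Nq}" for l
  proof -
    have th: "0 \<le> \<theta> l" using pos l by auto
    have g_mono: "g l j \<le> g l (Suc j)" for j
    proof (cases "j = 0")
      case True
      then show ?thesis using g_mode_lower[OF M th, of 1] order_trans[OF exp_ge_zero]
        by (auto simp: g_def g_mode_0)
    next
      case False
      then show ?thesis using g_mode_upper[OF M th, of j] g_mode_lower[OF M th, of "Suc j"] r
        by (fastforce simp: g_def)
    qed
    have "0 \<le> h l (Suc n) * (\<Sum>p=1..n. (g l p - g l (p-1)) * (\<Sum>j=p..n. y j)\<^sup>2)"
    proof (intro mult_nonneg_nonneg sum_nonneg)
      fix p assume "p \<in> {1..n}"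
      then show "0 \<le> g l p - g l (p-1)" using g_mono[of "p-1"] by simp
    qed (auto simp: h_def)
    also have "\<dots> \<le> (\<Sum>k=1..n. Q l k)" unfolding Q_def
      using g_mono tstar_mono[OF M a] th by (intro separable_form_lower_bound) (auto simp: h_def g_def g_mode_0 mult_left_mono)
    finally show ?thesis .
  qed
  have "2 * (beta \<alpha> Nq \<theta> w t k * (y k)\<^sup>2 + (\<Sum>j=1..k-1. d_hat \<alpha> Nq \<theta> w t k j * y j) * y k)
     = (\<Sum>l=1..Nq. w l * Q l k)" if "k \<in> {1..n}" for k
  proof -
    have pull: "2 * ((\<Sum>l=1..Nq. w l * X l) * c) = (\<Sum>l=1..Nq. w l * (2 * X l * c))" for X c
      by (simp add: sum_distrib_left sum_distrib_right mult_ac)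
    have sw: "(\<Sum>j=1..k-1. d_hat \<alpha> Nq \<theta> w t k j * y j) = (\<Sum>l=1..Nq. w l * (\<Sum>j=1..k-1. g l j * h l k * y j))"
      unfolding d sum_distrib_left sum_distrib_right by (subst sum.swap) (simp add: mult_ac)
    have "2 * (beta \<alpha> Nq \<theta> w t k * (y k)\<^sup>2) = (\<Sum>l=1..Nq. w l * ((g l k * h l (Suc k) + g l (k-1) * h l k - g l (k-1) * h l (Suc k)) * (y k)\<^sup>2))"
      using twice_beta[of k \<alpha> Nq \<theta> w t] that
      by (simp add: d mult.assoc[symmetric] flip: sum.distrib sum_subtractf) (simp add: sum_distrib_left sum_distrib_right algebra_simps)
    moreover have "2 * ((\<Sum>j=1..k-1. d_hat \<alpha> Nq \<theta> w t k j * y j) * y k)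
        = (\<Sum>l=1..Nq. w l * (2 * (\<Sum>j=1..k-1. g l j * h l k * y j) * y k))"
      unfolding sw by (rule pull)
    ultimately show ?thesis by (simp add: Q_def distrib_left sum.distrib)
  qed
  then have "2 * (\<Sum>k=1..n. beta \<alpha> Nq \<theta> w t k * (y k)\<^sup>2 + (\<Sum>j=1..k-1. d_hat \<alpha> Nq \<theta> w t k j * y j) * y k)
     = (\<Sum>l=1..Nq. w l * (\<Sum>k=1..n. Q l k))"
    unfolding sum_distrib_left by (subst sum.swap) (rule sum.cong, auto)
  also have "\<dots> \<ge> 0"
  proof (rule sum_nonneg)
    fix l assume "l \<in> {1..Nq}"
    then show "0 \<le> w l * (\<Sum>k=1..n. Q l k)"
      using step_l[of l] pos by (intro mult_nonneg_nonneg) blast+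
  qed
  finally show ?thesis by simp
qed

text \<open>
  For \<open>k \<ge> 2\<close>, twice \<open>beta\<close> is bounded by kernel values at the three points \<open>\<sigma> * \<tau>\<close> of the next step,
  \<open>\<sigma> * \<tau>\<close> of the current step, and the latter's \<open>\<tau>\<close> plus the former. These lie in the range of the
  approximation, so the kernel can be exchanged for the power at the cost of one \<open>\<epsilon>\<close> each. For
  \<open>k = 1\<close> the third point may exceed \<open>Tsoe\<close>, but only the first one occurs.
\<close>

lemma B_diag_nonneg:
  assumes a: "0 < \<alpha>" "\<alpha> < 1" and e: "\<epsilon> > 0"
    and S: "is_soe_approx \<alpha> \<epsilon> \<Delta>t Tsoe Nq \<theta> w"
    and M: "is_mesh t"
    and r: "\<And>k. k \<ge> 2 \<Longrightarrow> step_ratio t k \<ge> eta"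
    and eb: "\<And>k. k \<ge> 1 \<Longrightarrow> \<epsilon> \<le> 1 / (5 * (1 - \<alpha>) * (sigma_of \<alpha> * step t k) powr \<alpha>)"
    and lo: "\<And>k. k \<ge> 2 \<Longrightarrow> \<Delta>t \<le> sigma_of \<alpha> * step t k"
    and hi: "\<And>k. k \<ge> 2 \<Longrightarrow> Tsoe \<ge> sigma_of \<alpha> * step t (k + 1) + step t k"
    and k: "1 \<le> k"
  shows "0 \<le> B_diag \<alpha> Nq \<theta> w t k"
proof -
  let ?s = "sigma_of \<alpha>" and ?S = "soe Nq \<theta> w"
  have s: "0 < ?s" "?s < 1" using a by (auto simp: sigma_of_def)
  have pos: "\<forall>l \<in> {1..Nq}. 0 \<le> \<theta> l \<and> 0 \<le> w l" using S by (auto simp: is_soe_approx_def less_imp_le)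
  have close: "\<bar>x powr (- \<alpha>) - ?S x\<bar> \<le> \<epsilon>" if "\<Delta>t \<le> x" "x \<le> Tsoe" for x
    using S that by (auto simp: is_soe_approx_def less_imp_le)
  let ?x = "?s * step t k" and ?y = "?s * step t (k+1)"
  have st: "0 < step t k" "0 < step t (k+1)" using step_pos[OF M] k by auto
  have x: "0 < ?x" "0 < ?y" using s st by auto
  have z: "?x / ?s + ?y = step t k + ?y" using s by simp
  have le: "?s * step t i \<le> step t i" if "1 \<le> i" for i
    using mult_right_mono[of ?s 1 "step t i"] s step_pos[OF M that] by simp
  have "eta \<le> step t (k+1) / step t k" using r[of "k+1"] k by (simp add: step_ratio_def)
  with eta_gt have "475/1000 \<le> step t (k+1) / step t k" by linarith
  then have "475/1000 * step t k \<le> step t (k+1)" using st by (simp add: field_simps)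
  then have "475/1000 * ?x \<le> ?y" using s by (simp add: mult.left_commute)
  then have row: "?y powr (-\<alpha>) + ?x powr (-\<alpha>) - (step t k + ?y) powr (-\<alpha>) + 3 * \<epsilon>
     \<le> 2 * (?s / (1 - \<alpha>) * ?x powr (-\<alpha>))"
    using leading_coefficient_dominates[OF a x(1) _ eb[OF k], of ?y] z by (simp add: sigma_of_def)
  have leading: "?s powr (1 - \<alpha>) / ((1 - \<alpha>) * step t k powr \<alpha>) = ?s / (1 - \<alpha>) * ?x powr (-\<alpha>)"
    using s st by (simp add: powr_mult powr_minus powr_diff divide_inverse mult_ac)
  \<comment> \<open>The hypothesis on \<open>Tsoe\<close> starts at index \<open>2\<close>; for \<open>k = 1\<close> it still covers \<open>?y\<close>, since
    \<open>\<sigma> < 1\<close>.\<close>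
  have y_le: "?y \<le> Tsoe"
  proof (cases "k = 1")
    case True
    have "0 \<le> ?s * step t 3" using s step_pos[OF M, of 3] by simp
    then show ?thesis using le[of 2] hi[of 2] True by (simp add: numeral_2_eq_2 numeral_3_eq_3)
  next
    case False
    then show ?thesis using hi[of k] k st by simp
  qed
  have "\<bar>?y powr (- \<alpha>) - ?S ?y\<bar> \<le> \<epsilon>" using close[of ?y] lo[of "k+1"] k y_le by simp
  moreover have "d_hat \<alpha> Nq \<theta> w t (k+1) k \<le> ?S ?y"
    using d_hat_le_soe[OF M pos k r, where k = "k+1" and \<alpha> = \<alpha>] unfolding tstar_offsets(1) by simp
  ultimately have d1: "d_hat \<alpha> Nq \<theta> w t (k+1) k \<le> ?y powr (- \<alpha>) + \<epsilon>" by linarith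
  show ?thesis
  proof (cases "k = 1")
    case True
    have "(step t k + ?y) powr (-\<alpha>) \<le> ?x powr (-\<alpha>)"
      using a x le[OF k] by (intro powr_mono2') auto
    with row d1 e have "2 * beta \<alpha> Nq \<theta> w t k \<le> 2 * (?s / (1 - \<alpha>) * ?x powr (-\<alpha>))"
      using True by (simp add: beta_def numeral_2_eq_2)
    then show ?thesis using leading True by (simp add: B_diag_def)
  next
    case False
    then have k2: "2 \<le> k" using k by simp
    have "d_hat \<alpha> Nq \<theta> w t k (k-1) - d_hat \<alpha> Nq \<theta> w t (k+1) (k-1) \<le> ?S ?x - ?S (step t k + ?y)"
      using d_hat_decay_le_soe[OF M pos a, where j = "k-1" and k = k] r k2 unfolding tstar_offsets(2,3) by simp
    moreover have "\<bar>?x powr (- \<alpha>) - ?S ?x\<bar> \<le> \<epsilon>"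
      using close[of ?x] lo[OF k2] hi[OF k2] le[OF k] x(2) by simp
    moreover have "\<bar>(step t k + ?y) powr (- \<alpha>) - ?S (step t k + ?y)\<bar> \<le> \<epsilon>"
      using close[of "step t k + ?y"] lo[OF k2] hi[OF k2] le[OF k] x(2) by simp
    ultimately have "2 * beta \<alpha> Nq \<theta> w t k \<le> 2 * (?s / (1 - \<alpha>) * ?x powr (-\<alpha>))"
      using twice_beta[OF k, of \<alpha> Nq \<theta> w t] d1 row by linarith
    then show ?thesis using leading False c_hat_nonneg[OF M pos, of \<alpha> k "k-1"] by (simp add: B_diag_def)
  qed
qed

section \<open>Square integrability\<close>

lemma in_L2_integrable_times:
  assumes "in_L2 \<Omega> f" "in_L2 \<Omega> g"
  shows "integrable (lebesgue_on \<Omega>) (\<lambda>x. f x * g x)"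
proof (rule Bochner_Integration.integrable_bound)
  show "integrable (lebesgue_on \<Omega>) (\<lambda>x. (f x)\<^sup>2 + (g x)\<^sup>2)" using assms by (auto simp: in_L2_def)
  show "(\<lambda>x. f x * g x) \<in> borel_measurable (lebesgue_on \<Omega>)"
    using assms unfolding in_L2_def by (intro borel_measurable_times) blast+
  have "\<bar>p * q\<bar> \<le> p\<^sup>2 + q\<^sup>2" for p q :: real
  proof -
    have "2 * \<bar>p * q\<bar> \<le> p\<^sup>2 + q\<^sup>2"
      using sum_squares_bound[of "\<bar>p\<bar>" "\<bar>q\<bar>"] by (simp add: abs_mult)
    then show ?thesis by linarith
  qed
  then show "AE x in lebesgue_on \<Omega>. norm (f x * g x) \<le> norm ((f x)\<^sup>2 + (g x)\<^sup>2)" by auto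
qed

lemma in_L2_add:
  assumes "in_L2 \<Omega> f" "in_L2 \<Omega> g" shows "in_L2 \<Omega> (\<lambda>x. f x + g x)"
proof -
  have "integrable (lebesgue_on \<Omega>) (\<lambda>x. (f x)\<^sup>2 + (g x)\<^sup>2 + 2 * (f x * g x))"
    using assms in_L2_integrable_times[OF assms] by (intro Bochner_Integration.integrable_add integrable_mult_right) (auto simp: in_L2_def)
  with assms show ?thesis by (auto simp: in_L2_def power2_sum mult.assoc)
qed

lemma in_L2_scale: assumes "in_L2 \<Omega> f" shows "in_L2 \<Omega> (\<lambda>x. c * f x)"
  using assms by (auto simp: in_L2_def power_mult_distrib)

lemma in_L2_sum: "(\<And>i. i \<in> I \<Longrightarrow> in_L2 \<Omega> (f i)) \<Longrightarrow> in_L2 \<Omega> (\<lambda>x. \<Sum>i\<in>I. f i x)"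
proof (induction I rule: infinite_finite_induct)
  case (insert i I)
  then have "in_L2 \<Omega> (\<lambda>x. f i x + (\<Sum>i\<in>I. f i x))" by (intro in_L2_add) auto
  with insert.hyps show ?case by simp
next
  case empty show ?case by (simp add: in_L2_def)
next
  case (infinite I) then show ?case by (simp add: in_L2_def)
qed

lemma in_L2_delta: assumes "\<And>k. in_L2 \<Omega> (u (t k))" shows "in_L2 \<Omega> (\<delta> t u k)"
  using in_L2_add[OF assms[of k] in_L2_scale[OF assms[of "k-1"], of "-1"]] by (simp add: \<delta>_def)

lemma in_L2_F_op: assumes "\<And>k. in_L2 \<Omega> (u (t k))" shows "in_L2 \<Omega> (F_op \<alpha> Nq \<theta> w t u k)"
  unfolding F_op_def by (intro in_L2_add in_L2_scale in_L2_sum in_L2_delta assms)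

lemma L2_norm_square: "(L2_norm \<Omega> f)\<^sup>2 = L2_inner \<Omega> f f"
  unfolding L2_norm_def by (intro real_sqrt_pow2) (simp add: L2_inner_def)

lemma F_op_split:
  assumes a: "\<alpha> < 1" and k: "1 \<le> k"
  shows "F_op \<alpha> Nq \<theta> w t u k x * \<delta> t u k x = B_diag \<alpha> Nq \<theta> w t k / Gamma (1 - \<alpha>) * (\<delta> t u k x)\<^sup>2
    + (beta \<alpha> Nq \<theta> w t k * (\<delta> t u k x)\<^sup>2
       + (\<Sum>j=1..k-1. d_hat \<alpha> Nq \<theta> w t k j * \<delta> t u j x) * \<delta> t u k x) / Gamma (1 - \<alpha>)"
proof -
  let ?y = "\<delta> t u k x" and ?S = "\<Sum>j=1..k-1. d_hat \<alpha> Nq \<theta> w t k j * \<delta> t u j x"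
  let ?L = "sigma_of \<alpha> powr (1 - \<alpha>) / ((1 - \<alpha>) * step t k powr \<alpha>)" and ?c = "c_hat \<alpha> Nq \<theta> w t k (k-1)"
  have "Gamma (2 - \<alpha>) = (1 - \<alpha>) * Gamma (1 - \<alpha>)"
    using Gamma_plus1[of "1 - \<alpha>"] a by (simp add: add.commute nonpos_Ints_def)
  then have "F_op \<alpha> Nq \<theta> w t u k x = (?c * ?y + ?S + ?L * ?y) / Gamma (1 - \<alpha>)"
    by (simp add: F_op_def divide_inverse distrib_left mult_ac)
  moreover have "B_diag \<alpha> Nq \<theta> w t k = ?L + ?c - beta \<alpha> Nq \<theta> w t k"
    using k by (auto simp: B_diag_def c_hat_def)
  moreover have "(c * y + S + L * y) / G * y = (L + c - b) / G * y\<^sup>2 + (b * y\<^sup>2 + S * y) / G"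
    for c y S L G b :: real
    by (simp add: divide_inverse power2_eq_square algebra_simps)
  ultimately show ?thesis by simp
qed

theorem theorem3p2:
  fixes \<alpha> \<epsilon> \<Delta>t Tsoe :: real
    and Nq n :: nat
    and \<theta> w t :: "nat \<Rightarrow> real"
    and \<Omega> :: "(real ^ 'd) set"
    and u :: "real \<Rightarrow> real ^ 'd \<Rightarrow> real"
  assumes "0 < \<alpha>" and "\<alpha> < 1"
    and "\<epsilon> > 0" and "\<Delta>t > 0" and "Tsoe > \<Delta>t"
    and "is_soe_approx \<alpha> \<epsilon> \<Delta>t Tsoe Nq \<theta> w"
    and "is_mesh t"
    and "\<And>k. k \<ge> 2 \<Longrightarrow> step_ratio t k \<ge> eta"
    and "\<And>k. k \<ge> 1 \<Longrightarrow> \<epsilon> \<le> 1 / (5 * (1 - \<alpha>) * (sigma_of \<alpha> * step t k) powr \<alpha>)"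
    and "\<And>k. k \<ge> 2 \<Longrightarrow> \<Delta>t \<le> sigma_of \<alpha> * step t k"
    and "\<And>k. k \<ge> 2 \<Longrightarrow> Tsoe \<ge> sigma_of \<alpha> * step t (k + 1) + step t k"
    and "bounded_lipschitz_domain \<Omega>"
    and "\<And>k. in_L2 \<Omega> (u (t k))"
    and "n \<ge> 1"
  shows "B_form \<Omega> \<alpha> Nq \<theta> w t n u u
           \<ge> (\<Sum>k = 1..n. B_diag \<alpha> Nq \<theta> w t k / Gamma (1 - \<alpha>) * (L2_norm \<Omega> (\<delta> t u k))\<^sup>2)
       \<and> (\<Sum>k = 1..n. B_diag \<alpha> Nq \<theta> w t k / Gamma (1 - \<alpha>) * (L2_norm \<Omega> (\<delta> t u k))\<^sup>2) \<ge> 0"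
proof
  have G: "0 < Gamma (1 - \<alpha>)" using assms(2) by (intro Gamma_real_pos) simp
  have pos: "\<forall>l \<in> {1..Nq}. 0 \<le> \<theta> l \<and> 0 \<le> w l" using assms(6) by (auto simp: is_soe_approx_def less_imp_le)
  have \<delta>: "in_L2 \<Omega> (\<delta> t u k)" for k by (rule in_L2_delta) (rule assms)
  have F: "in_L2 \<Omega> (F_op \<alpha> Nq \<theta> w t u k)" for k by (rule in_L2_F_op) (rule assms)
  let ?B = "\<lambda>k. B_diag \<alpha> Nq \<theta> w t k / Gamma (1 - \<alpha>)"
  have pt: "(\<Sum>k=1..n. ?B k * (\<delta> t u k x * \<delta> t u k x)) \<le> (\<Sum>k=1..n. F_op \<alpha> Nq \<theta> w t u k x * \<delta> t u k x)" for x
    using beta_form_nonneg[OF assms(7) pos assms(1,2) assms(8), where n = n and y = "\<lambda>k. \<delta> t u k x"] G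
    by (simp add: F_op_split[OF assms(2)] sum.distrib flip: power2_eq_square sum_divide_distrib)
  have "(\<Sum>k = 1..n. ?B k * (L2_norm \<Omega> (\<delta> t u k))\<^sup>2)
      = integral\<^sup>L (lebesgue_on \<Omega>) (\<lambda>x. \<Sum>k=1..n. ?B k * (\<delta> t u k x * \<delta> t u k x))"
    by (subst Bochner_Integration.integral_sum)
       (auto intro!: integrable_mult_right in_L2_integrable_times \<delta> simp: L2_norm_square L2_inner_def)
  also have "\<dots> \<le> integral\<^sup>L (lebesgue_on \<Omega>) (\<lambda>x. \<Sum>k=1..n. F_op \<alpha> Nq \<theta> w t u k x * \<delta> t u k x)"
    by (intro integral_mono pt Bochner_Integration.integrable_sum integrable_mult_right in_L2_integrable_times \<delta> F)
  also have "\<dots> = B_form \<Omega> \<alpha> Nq \<theta> w t n u u"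
    unfolding B_form_def L2_inner_def by (rule Bochner_Integration.integral_sum) (intro in_L2_integrable_times \<delta> F)
  finally show "(\<Sum>k = 1..n. ?B k * (L2_norm \<Omega> (\<delta> t u k))\<^sup>2) \<le> B_form \<Omega> \<alpha> Nq \<theta> w t n u u" .
  show "(\<Sum>k = 1..n. ?B k * (L2_norm \<Omega> (\<delta> t u k))\<^sup>2) \<ge> 0"
    using G B_diag_nonneg[OF assms(1-3,6-11)] by (intro sum_nonneg mult_nonneg_nonneg divide_nonneg_pos) auto
qed

end
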